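(* Let $X$ be a real Hilbert space and let $f\colon X\to\mathbb{R}$ be convex and continuous with $C_f=\{x\in X: f(x)\le0\}\neq\varnothing$. Let $\alpha>0$, let $A\colon X\to X$ be continuous and linear such that $AA^*=A^*A=\mathrm{Id}$, and let $z\in X$. Furthermore, let $(f_i)_{i\in I}$ be a finite family of convex continuous functions on $X$ such that $\bigcap_{i\in I}C_{f_i}\neq\varnothing$. Then the following hold: (i) If $g=\alpha f$, then $C_g=C_f$ and $\mathcal{G}_g=\mathcal{G}_f$. (ii) If $g=f\circ\alpha\,\mathrm{Id}$, then $C_g=\alpha^{-1}C_f$ and $\mathcal{G}_g=\alpha^{-1}\mathcal{G}_f\circ\alpha\,\mathrm{Id}$. (iii) If $f\ge0$ and $g=f^\alpha$ is convex, then $C_g=C_f$ and $\mathcal{G}_g=(1-\alpha^{-1})\mathrm{Id}+\alpha^{-1}\mathcal{G}_f$. (iv) If $g=f\circ A$, then $C_g=A^*C_f$ and $\mathcal{G}_g=A^*\circ\mathcal{G}_f\circ A$. (v) If $g\colon x\mapsto f(x-z)$, then $C_g=z+C_f$ and $\mathcal{G}_g\colon x\mapsto z+\mathcal{G}_f(x-z)$. (vi) If $g=\max_{i\in I}f_i$, then $C_g=\bigcap_{i\in I}C_{f_i}$, and if $g(x)>0$ and $I(x)=\{i\in I: f_i(x)=g(x)\}$, then $\mathcal{G}_g(x)=\{x-g(x)\|x^*\|^{-2}x^* : x^*\in\operatorname{conv}\bigcup_{i\in I(x)}\partial f_i(x)\}$. (vii) If $g=f^+=\max\{f,0\}$, then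 $\mathcal{G}_g=\mathcal{G}_f$. (viii) (Moreau envelope) If $\min f(X)=0$ and $g=f\,\Box\,\tfrac12\|\cdot\|^2$ is the Moreau envelope of $f$, then $C_g=C_f$ and, for every $x\in X$, $$G_g(x)=\begin{cases}x-\dfrac{g(x)}{\|x-\mathrm{P}_fx\|^2}(x-\mathrm{P}_fx),&\text{if }f(x)>0;\\ x,&\text{if }f(x)=0.\end{cases}$$
   Context: For a convex continuous $h\colon X\to\mathbb{R}$, set $C_h=\{x\in X: h(x)\le 0\}$. If $C_h\neq\varnothing$ and $s$ is a selection of the convex subdifferential $\partial h$ (i.e., $s(x)\in\partial h(x)$ for all $x$), the associated subgradient projector is $G_{h,s}(x)=x-\frac{h(x)}{\|s(x)\|^2}s(x)$ if $h(x)>0$, and $G_{h,s}(x)=x$ otherwise. The set-valued operator $\mathcal{G}_h\colon X\rightrightarrows X$ is $\mathcal{G}_h(x)=\{G_{h,s}(x): s\text{ is a selection of }\partial h\}$. When $h$ is Gâteaux differentiable outside $C_h$, $\mathcal{G}_h$ is single-valued and is identified with $G_h$. $\mathrm{P}_f=(\mathrm{Id}+\partial f)^{-1}$ is the proximity operator, and $\Box$ denotes infimal convolution: $(f\,\Box\,\tfrac12\|\cdot\|^2)(x)=\inf_{y\in X}\big(f(y)+\tfrac12\|x-y\|^2\big)$. *)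

theory Defs
  imports "HOL-Analysis.Analysis"
begin

definition zero_sublevel :: "('a \<Rightarrow> real) \<Rightarrow> 'a set" where
  "zero_sublevel h = {x. h x \<le> 0}"

definition subdifferential :: "('a::real_inner \<Rightarrow> real) \<Rightarrow> 'a \<Rightarrow> 'a set" where
  "subdifferential h x = {u. \<forall>y. inner (y - x) u + h x \<le> h y}"

definition subgrad_selection :: "('a::real_inner \<Rightarrow> real) \<Rightarrow> ('a \<Rightarrow> 'a) \<Rightarrow> bool" where
  "subgrad_selection h s \<longleftrightarrow> (\<forall>x. s x \<in> subdifferential h x)"

text \<open>When \<open>h x > 0\<close> and \<open>zero_sublevel h\<close> is nonempty, \<open>x\<close> is not a minimizer of \<open>h\<close>,
  so every subgradient \<open>s x\<close> is nonzero and the division is a genuine one.\<close>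

definition subgrad_proj :: "('a::real_inner \<Rightarrow> real) \<Rightarrow> ('a \<Rightarrow> 'a) \<Rightarrow> 'a \<Rightarrow> 'a" where
  "subgrad_proj h s x = (if h x > 0 then x - (h x / (norm (s x))\<^sup>2) *\<^sub>R s x else x)"

text \<open>The set-valued operator \<open>\<G>\<^sub>h\<close>. That it is single-valued at \<open>x\<close>
  with value \<open>p\<close> is expressed by \<open>subgrad_proj_set h x = {p}\<close>.\<close>

definition subgrad_proj_set :: "('a::real_inner \<Rightarrow> real) \<Rightarrow> 'a \<Rightarrow> 'a set" where
  "subgrad_proj_set h x = {subgrad_proj h s x | s. subgrad_selection h s}"

text \<open>The proximity operator \<open>(Id + \<partial>f)\<^sup>-\<^sup>1\<close>. For convex continuous \<open>f\<close> on a Hilbert space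
  the inverse relation is the graph of a function defined everywhere,
  so the definite description is well defined.\<close>

definition prox :: "('a::real_inner \<Rightarrow> real) \<Rightarrow> 'a \<Rightarrow> 'a" where
  "prox f x = (THE p. \<exists>u \<in> subdifferential f p. x = p + u)"

text \<open>Real-valued infimal convolution. The infimum is meaningful only if, for each \<open>x\<close>, the
  function \<open>y \<mapsto> f y + h (x - y)\<close> is bounded below.\<close>

definition inf_conv :: "('a::real_inner \<Rightarrow> real) \<Rightarrow> ('a \<Rightarrow> real) \<Rightarrow> 'a \<Rightarrow> real" where
  "inf_conv f h x = (INF y. f y + h (x - y))"

end

(*
The subgradient projector at x depends only on the subdifferential at x once all subdifferentials are
nonempty, so every item reduces to a calculus rule for subdifferentials. Nonemptiness is obtained
without weak compactness: the Yosida regularizations form a strongly Cauchy sequence. The same fact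
yields the Riesz representation (hence the adjoint) and, applied to the value function of a perturbed
minimization problem, the formula for the subdifferential of a maximum, by splitting off one function
at a time. For the powers of f, both inclusions of the chain rule are the same one-sided derivative
estimate, because f is in turn a power of f^alpha.
*)
theory Submission
  imports Defs
begin

section \<open>Subgradients and one-sided derivatives\<close>

text \<open>A selection is global although the projector at x sees only its value there.
  Nonemptiness is therefore needed at every point, but an exact subdifferential rule only where the
  function is positive; the rules for powers and for the positive part are proved only there. For a
  maximum, u is a subgradient at x when x minimizes max f h minus the linear form of u. Two
  perturbations are needed: a level added to f, whose multiplier is the convex weight, and a shift
  of the argument of f, which lets f and h be evaluated at unrelated points, so that each gets its
  own subgradient inequality. The obstacle is continuity of the value function, without which it
  might have no subgradient; reflecting the perturbation bounds it from below.\<close>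

lemma subdifferentialI: "(\<And>y. inner (y - x) u + f x \<le> f y) \<Longrightarrow> u \<in> subdifferential f x"
  by (simp add: subdifferential_def)

lemma subdifferentialD: "u \<in> subdifferential f x \<Longrightarrow> inner (y - x) u + f x \<le> f y"
  by (simp add: subdifferential_def)

lemma convex_on_segment_le:
  assumes "convex_on UNIV f" "0 \<le> t" "t \<le> 1"
  shows "f (x + t *\<^sub>R (y - x)) \<le> f x + t * (f y - f x)"
proof -
  have eq: "x + t *\<^sub>R (y - x) = (1 - t) *\<^sub>R x + t *\<^sub>R y"
    by (simp add: algebra_simps)
  show ?thesis
    unfolding eq using convex_onD[OF assms, of x y] by (simp add: algebra_simps)
qed

text \<open>Along a segment from x to y, convexity bounds the difference quotients of f by f y - f
  x. A lower model \<psi> thus has to be valid only for small t > 0, and its slope at 0 gives the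
  global inequality. Quadratic errors in the model are harmless.\<close>

lemma subdifferential_directionalI:
  fixes f :: "'a::real_inner \<Rightarrow> real"
  assumes f: "convex_on UNIV f"
    and psi0: "\<And>y. \<psi> y 0 = f x"
    and deriv: "\<And>y. (\<psi> y has_real_derivative inner (y - x) u) (at 0 within {0<..})"
    and le: "\<And>y. \<forall>\<^sub>F t in at_right 0. \<psi> y t \<le> f (x + t *\<^sub>R (y - x))"
  shows "u \<in> subdifferential f x"
proof (rule subdifferentialI)
  fix y
  have lim: "((\<lambda>t. (\<psi> y t - \<psi> y 0) / t) \<longlongrightarrow> inner (y - x) u) (at_right 0)"
    using deriv[of y] by (simp add: has_field_derivative_iff)
  have "\<forall>\<^sub>F t in at_right 0. (\<psi> y t - \<psi> y 0) / t \<le> f y - f x"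
    using le[of y] eventually_at_right_less[of 0] eventually_at_right_real[OF zero_less_one]
  proof eventually_elim
    case (elim t)
    then have "\<psi> y t \<le> f x + t * (f y - f x)"
      using convex_on_segment_le[OF f, of t x y] by simp
    with elim show ?case
      by (simp add: psi0 field_simps)
  qed
  then have "inner (y - x) u \<le> f y - f x"
    by (intro tendsto_upperbound[OF lim]) auto
  then show "inner (y - x) u + f x \<le> f y" by simp
qed

text \<open>Convexity makes it enough to test the subgradient inequality near x. This allows a
  maximum to be replaced by its strictly largest member.\<close>

lemma subdifferential_local:
  fixes f :: "'a::real_inner \<Rightarrow> real"
  assumes f: "convex_on UNIV f"
    and le: "\<forall>\<^sub>F y in nhds x. g y \<le> f y" and eq: "g x = f x"
    and u: "u \<in> subdifferential g x"
  shows "u \<in> subdifferential f x"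
proof (rule subdifferential_directionalI[OF f, where \<psi> = "\<lambda>y t. f x + t * inner (y - x) u"])
  fix y
  show "((\<lambda>t. f x + t * inner (y - x) u) has_real_derivative inner (y - x) u) (at 0 within {0<..})"
    by (auto intro!: derivative_eq_intros)
  have "((\<lambda>t. x + t *\<^sub>R (y - x)) \<longlongrightarrow> x + 0 *\<^sub>R (y - x)) (at_right (0::real))"
    by (intro tendsto_intros)
  then have "filterlim (\<lambda>t. x + t *\<^sub>R (y - x)) (nhds x) (at_right (0::real))"
    by simp
  from eventually_compose_filterlim[OF le this]
  show "\<forall>\<^sub>F t in at_right 0. f x + t * inner (y - x) u \<le> f (x + t *\<^sub>R (y - x))"
  proof eventually_elim
    case (elim t)
    then show ?case
      using subdifferentialD[OF u, of "x + t *\<^sub>R (y - x)"] by (simp add: eq)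
  qed
qed simp

text \<open>Convexity is asked of the composite and not of \<phi>, so \<phi> may be a concave power.
  For small t the affine lower bound of f stays in S, so \<phi> has to be monotone only from there
  upwards.\<close>

lemma subdifferential_comp_mono:
  fixes f :: "'a::real_inner \<Rightarrow> real"
  assumes conv: "convex_on UNIV (\<lambda>x. \<phi> (f x))"
    and deriv: "(\<phi> has_real_derivative c) (at (f x))"
    and S: "open S" "f x \<in> S"
    and mono: "\<And>a b. a \<in> S \<Longrightarrow> a \<le> b \<Longrightarrow> \<phi> a \<le> \<phi> b"
    and u: "u \<in> subdifferential f x"
  shows "c *\<^sub>R u \<in> subdifferential (\<lambda>x. \<phi> (f x)) x"
proof (rule subdifferential_directionalI[OF conv, where \<psi> = "\<lambda>y t. \<phi> (f x + t * inner (y - x) u)"])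
  fix y
  have "((\<lambda>t. f x + t * inner (y - x) u) has_real_derivative inner (y - x) u) (at 0 within {0<..})"
    by (auto intro!: derivative_eq_intros)
  from DERIV_chain2[OF _ this, of \<phi> c] deriv
  show "((\<lambda>t. \<phi> (f x + t * inner (y - x) u)) has_real_derivative inner (y - x) (c *\<^sub>R u))
      (at 0 within {0<..})"
    by simp
  have "((\<lambda>t. f x + t * inner (y - x) u) \<longlongrightarrow> f x + 0 * inner (y - x) u) (at_right (0::real))"
    by (intro tendsto_intros)
  then have "((\<lambda>t. f x + t * inner (y - x) u) \<longlongrightarrow> f x) (at_right (0::real))"
    by simp
  from topological_tendstoD[OF this S]
  show "\<forall>\<^sub>F t in at_right 0. \<phi> (f x + t * inner (y - x) u) \<le> \<phi> (f (x + t *\<^sub>R (y - x)))"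
  proof eventually_elim
    case (elim t)
    then show ?case
      using subdifferentialD[OF u, of "x + t *\<^sub>R (y - x)"] by (intro mono) auto
  qed
qed simp

text \<open>Near x, f is at most f x + 1 on a ball of radius r. Since x lies between y and the point
  z at distance r on the far side, too low a value at y would push f z above this bound. The
  resulting slope is 1 / r.\<close>

lemma convex_on_cone_minorant:
  fixes f :: "'a::real_inner \<Rightarrow> real"
  assumes f: "convex_on UNIV f" and cont: "isCont f x"
  obtains K where "K > 0" "\<And>y. f x - K * norm (y - x) \<le> f y"
proof -
  from cont obtain d where d: "d > 0" "\<And>z. dist z x < d \<Longrightarrow> dist (f z) (f x) < 1"
    unfolding continuous_at_eps_delta by (meson zero_less_one)
  define r where "r = d / 2"
  have r: "r > 0"
    using d by (simp add: r_def)
  have upper: "f z \<le> f x + 1" if "norm (z - x) \<le> r" for z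
    using d(1) d(2)[of z] that by (simp add: r_def dist_norm)
  show ?thesis
  proof (rule that[of "1 / r"])
    fix y
    show "f x - 1 / r * norm (y - x) \<le> f y"
    proof (cases "y = x")
      case False
      define n where "n = norm (y - x)"
      have n: "n > 0" using False by (simp add: n_def)
      define z where "z = x - (r / n) *\<^sub>R (y - x)"
      have z: "f z \<le> f x + 1"
        by (rule upper) (use n r in \<open>simp add: z_def n_def\<close>)
      have "y - z = ((r + n) / n) *\<^sub>R (y - x)"
        using n by (simp add: z_def add_divide_distrib scaleR_left_distrib)
      then have "x = z + (r / (r + n)) *\<^sub>R (y - z)"
        using n r by (simp add: z_def)
      then have "f x \<le> f z + r / (r + n) * (f y - f z)"
        using convex_on_segment_le[OF f, of "r / (r + n)" z y] n r by simp
      then have "(r + n) * f x \<le> (r + n) * (f z + r / (r + n) * (f y - f z))"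
        using n r by (intro mult_left_mono) auto
      also have "\<dots> = n * f z + r * f y"
        using n r by (simp add: field_simps)
      also have "\<dots> \<le> n * (f x + 1) + r * f y"
        using n z by simp
      finally show ?thesis
        using n r by (simp add: field_simps n_def)
    qed simp
  qed (use r in simp)
qed

section \<open>Existence of proximal points and subgradients\<close>

text \<open>The parallelogram law, with the midpoint in the form produced by
  \<open>convex_on_segment_le\<close>.\<close>

lemma midpoint_norm_sq:
  fixes a b x :: "'a::real_inner"
  shows "(norm (a + (1/2) *\<^sub>R (b - a) - x))\<^sup>2
    = ((norm (a - x))\<^sup>2 + (norm (b - x))\<^sup>2) / 2 - (norm (a - b))\<^sup>2 / 4"
proof -
  define u d where ud: "u = a - x" "d = b - a"
  have "(norm (u + (1/2) *\<^sub>R d))\<^sup>2 = ((norm u)\<^sup>2 + (norm (u + d))\<^sup>2) / 2 - (norm d)\<^sup>2 / 4"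
    by (simp add: power2_norm_eq_inner inner_add_left inner_add_right inner_commute[of d u]
        add_divide_distrib)
  moreover have "a + (1/2) *\<^sub>R (b - a) - x = u + (1/2) *\<^sub>R d" "b - x = u + d"
    by (simp_all add: ud)
  ultimately show ?thesis
    by (metis ud norm_minus_commute)
qed

text \<open>The quadratic term makes the objective strongly convex, so minimizing sequences are
  Cauchy and completeness takes the place of compactness. The claim is the first-order condition at
  the minimizer.\<close>

lemma prox_point_exists:
  fixes f :: "'a::{real_inner, complete_space} \<Rightarrow> real"
  assumes f: "convex_on UNIV f" and cont: "continuous_on UNIV f"
  shows "\<exists>p. x - p \<in> subdifferential f p"
proof -
  define J where "J y = f y + (norm (y - x))\<^sup>2 / 2" for y
  have contf: "isCont f y" for y
    using cont by (simp add: continuous_on_eq_continuous_at)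
  obtain K where K: "\<And>y. f x - K * norm (y - x) \<le> f y"
    using convex_on_cone_minorant[OF f contf] by blast
  \<comment> \<open>Completing the square: the quadratic term outweighs the linear decay of the cone
    minorant.\<close>
  have lower: "f x - K\<^sup>2 / 2 \<le> J y" for y
  proof -
    have "K * norm (y - x) \<le> K\<^sup>2 / 2 + (norm (y - x))\<^sup>2 / 2"
      using zero_le_power2[of "K - norm (y - x)"] by (simp add: power2_diff)
    then show ?thesis
      using K[of y] by (simp add: J_def)
  qed
  then have bdd: "bdd_below (range J)"
    by (intro bdd_belowI2)
  define m where "m = Inf (range J)"
  have m: "m \<le> J y" for y
    unfolding m_def using bdd by (intro cInf_lower) auto
  have "\<exists>y. J y < m + 1 / real (Suc n)" for n
  proof -
    have "m < m + 1 / real (Suc n)" by simp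
    then show ?thesis
      using cInf_lessD[of "range J" "m + 1 / real (Suc n)"] by (auto simp: m_def)
  qed
  then obtain Y where Y: "\<And>n. J (Y n) < m + 1 / real (Suc n)"
    by metis
  \<comment> \<open>The midpoint has level at least m, yet lies an eighth of the squared distance
    below the average of J a and J b; hence near-minimizers are close to each other.\<close>
  have gap: "(norm (a - b))\<^sup>2 \<le> 4 * ((J a - m) + (J b - m))" for a b
  proof -
    have "f (a + (1/2) *\<^sub>R (b - a)) \<le> (f a + f b) / 2"
    proof -
      have "c \<le> (p + q) / 2" if "c \<le> p + 1 / 2 * (q - p)" for c p q :: real
        using that by (simp add: field_simps)
      from this[OF convex_on_segment_le[OF f]] show ?thesis by simp
    qed
    then have "J (a + (1/2) *\<^sub>R (b - a)) \<le> (J a + J b) / 2 - (norm (a - b))\<^sup>2 / 8"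
      by (simp add: J_def midpoint_norm_sq diff_divide_distrib add_divide_distrib)
    with m[of "a + (1/2) *\<^sub>R (b - a)"]
    have "m \<le> (J a + J b) / 2 - (norm (a - b))\<^sup>2 / 8"
      by (rule order_trans)
    then show ?thesis
      by (simp add: field_simps)
  qed
  have "Cauchy Y"
  proof (rule metric_CauchyI)
    fix e :: real assume "e > 0"
    \<comment> \<open>The 8 is the factor 4 of \<open>gap\<close> times two excesses below 1 / (N +
      1).\<close>
    then obtain N where N: "8 / e\<^sup>2 < real N"
      using reals_Archimedean2 by blast
    show "\<exists>M. \<forall>m\<ge>M. \<forall>n\<ge>M. dist (Y m) (Y n) < e"
    proof (intro exI allI impI)
      fix i j assume ij: "i \<ge> N" "j \<ge> N"
      have le: "J (Y k) - m < 1 / real (Suc N)" if "k \<ge> N" for k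
        using Y[of k] frac_le[of 1 1 "real (Suc N)" "real (Suc k)"] that by simp
      have "(norm (Y i - Y j))\<^sup>2 < 8 / real (Suc N)"
        using gap[of "Y i" "Y j"] le[OF ij(1)] le[OF ij(2)] by simp
      also have "\<dots> < e\<^sup>2"
      proof -
        have "8 < real N * e\<^sup>2" "0 < e\<^sup>2"
          using N \<open>e > 0\<close> by (simp_all add: pos_divide_less_eq)
        then have "8 < e\<^sup>2 * real (Suc N)"
          by (simp only: of_nat_Suc distrib_left mult.commute[of "real N"])
        then show ?thesis
          by (simp add: pos_divide_less_eq)
      qed
      finally show "dist (Y i) (Y j) < e"
        using \<open>e > 0\<close> by (simp add: dist_norm power_less_imp_less_base)
    qed
  qed
  then obtain p where p: "Y \<longlonglongrightarrow> p"
    using Cauchy_convergent convergent_def by blast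
  have "(\<lambda>n. J (Y n)) \<longlonglongrightarrow> J p"
    unfolding J_def by (intro tendsto_intros isCont_tendsto_compose[OF contf] p) simp
  moreover have "(\<lambda>n. m + 1 / real (Suc n)) \<longlonglongrightarrow> m + 0"
    by (intro tendsto_intros LIMSEQ_Suc[OF lim_1_over_n])
  ultimately have Jp: "J p \<le> m"
    using LIMSEQ_le[of "\<lambda>n. J (Y n)" "J p" "\<lambda>n. m + 1 / real (Suc n)"] Y
    by (auto intro: less_imp_le)
  have quad: "((\<lambda>t. a + t * b - t\<^sup>2 * k) has_real_derivative b) (at 0 within S)"
    for a b k :: real and S
    by (auto intro!: derivative_eq_intros)
  \<comment> \<open>Minimality of p gives the linear lower bound only up to a term in the square of
    t, which does not change the slope at 0.\<close>
  have "x - p \<in> subdifferential f p"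
  proof (rule subdifferential_directionalI[OF f,
        where \<psi> = "\<lambda>y t. f p + t * inner (y - p) (x - p) - t\<^sup>2 * ((norm (y - p))\<^sup>2 / 2)"])
    fix y
    show "((\<lambda>t. f p + t * inner (y - p) (x - p) - t\<^sup>2 * ((norm (y - p))\<^sup>2 / 2))
        has_real_derivative inner (y - p) (x - p)) (at 0 within {0<..})"
      by (rule quad)
    have "f p + t * inner (y - p) (x - p) - t\<^sup>2 * ((norm (y - p))\<^sup>2 / 2) \<le> f (p + t *\<^sub>R (y - p))" for t
    proof -
      have "(norm (p + t *\<^sub>R (y - p) - x))\<^sup>2
          = (norm (p - x))\<^sup>2 - 2 * t * inner (y - p) (x - p) + t\<^sup>2 * (norm (y - p))\<^sup>2"
        unfolding power2_norm_eq_inner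
        by (simp add: inner_diff_left inner_diff_right inner_add_left inner_add_right
            inner_commute power2_eq_square algebra_simps)
      with Jp m[of "p + t *\<^sub>R (y - p)"] show ?thesis
        by (simp add: J_def add_divide_distrib diff_divide_distrib)
    qed
    then show "\<forall>\<^sub>F t in at_right 0. f p + t * inner (y - p) (x - p) - t\<^sup>2 * ((norm (y - p))\<^sup>2 / 2)
        \<le> f (p + t *\<^sub>R (y - p))"
      by simp
  qed simp
  then show ?thesis ..
qed

lemma subdifferential_cmult:
  assumes "c > 0"
  shows "subdifferential (\<lambda>x. c * f x) x = (*\<^sub>R) c ` subdifferential f x"
proof -
  have *: "c *\<^sub>R u \<in> subdifferential (\<lambda>x. c * f x) x \<longleftrightarrow> u \<in> subdifferential f x" for u
  proof -
    have "inner (y - x) (c *\<^sub>R u) + c * f x = c * (inner (y - x) u + f x)" for y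
      by (simp add: distrib_left)
    then show ?thesis
      using assms by (simp add: subdifferential_def mult_le_cancel_left_pos del: inner_scaleR_right)
  qed
  show ?thesis
  proof (intro set_eqI iffI)
    fix v assume v: "v \<in> subdifferential (\<lambda>x. c * f x) x"
    have eq: "v = c *\<^sub>R (inverse c *\<^sub>R v)"
      using assms by simp
    with v * show "v \<in> (*\<^sub>R) c ` subdifferential f x"
      by (metis imageI)
  qed (use * in blast)
qed

text \<open>The Yosida regularizations at \<open>x\<close> have increasing norms as their parameter decreases, so they
  form a Cauchy sequence; this avoids both weak compactness and the Hahn-Banach theorem.\<close>

lemma subdifferential_nonempty:
  fixes f :: "'a::{real_inner, complete_space} \<Rightarrow> real"
  assumes f: "convex_on UNIV f" and cont: "continuous_on UNIV f"
  shows "subdifferential f x \<noteq> {}"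
proof -
  have contf: "isCont f y" for y
    using cont by (simp add: continuous_on_eq_continuous_at)
  obtain K where K: "K > 0" "\<And>y. f x - K * norm (y - x) \<le> f y"
    using convex_on_cone_minorant[OF f contf] by blast
  define l where "l n = 1 / real (Suc n)" for n
  have l: "l n > 0" for n by (simp add: l_def)
  \<comment> \<open>The proximal point p of \<open>l n * f\<close> gives the Yosida regularization
    (x - p) / l n, a subgradient of f at p instead of x.\<close>
  have "\<exists>u. u \<in> subdifferential f (x - l n *\<^sub>R u)" for n
  proof -
    have "convex_on UNIV (\<lambda>y. l n * f y)" "continuous_on UNIV (\<lambda>y. l n * f y)"
      using l[of n] f cont by (auto intro!: convex_on_cmul continuous_intros)
    from prox_point_exists[OF this, of x] obtain p u
      where xp: "x - p = l n *\<^sub>R u" and u: "u \<in> subdifferential f p"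
      unfolding subdifferential_cmult[OF l] by blast
    have "x - l n *\<^sub>R u = p"
      by (simp flip: xp)
    with u show ?thesis by metis
  qed
  then obtain u where u: "\<And>n. u n \<in> subdifferential f (x - l n *\<^sub>R u n)"
    by metis
  \<comment> \<open>The subgradient inequality at the proximal point, tested at x, meets the cone
    minorant, whose slope does not depend on n.\<close>
  have bound: "norm (u n) \<le> K" for n
  proof -
    have "l n * (norm (u n))\<^sup>2 + f (x - l n *\<^sub>R u n) \<le> f x"
      using subdifferentialD[OF u, of x n] by (simp add: power2_norm_eq_inner)
    moreover have "f x - K * (l n * norm (u n)) \<le> f (x - l n *\<^sub>R u n)"
      using K(2)[of "x - l n *\<^sub>R u n"] l[of n] by simp
    ultimately have "l n * (norm (u n))\<^sup>2 \<le> K * (l n * norm (u n))"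
      by linarith
    then have "l n * (norm (u n) * norm (u n)) \<le> l n * (K * norm (u n))"
      by (simp only: power2_eq_square mult.left_commute[of K])
    then have "norm (u n) * norm (u n) \<le> K * norm (u n)"
      using l[of n] mult_le_cancel_left_pos by blast
    then show ?thesis
      using K(1) by (cases "u n = 0") auto
  qed
  \<comment> \<open>The proximal points differ by
    \<open>l k *\<^sub>R u k - l n *\<^sub>R u n\<close>, which is (l k - l n) u k - l n (u n - u
    k). Monotonicity of the subdifferential then makes the inner product of u k and u n - u k
    nonnegative, and expanding the square gives the estimate.\<close>
  have dist_le: "(norm (u n - u k))\<^sup>2 \<le> (norm (u n))\<^sup>2 - (norm (u k))\<^sup>2" if "k \<le> n" for k n
  proof (cases "k = n")
    case False
    have "l n < l k"
      using that False by (simp add: l_def frac_less2)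
    have "0 \<le> inner (l k *\<^sub>R u k - l n *\<^sub>R u n) (u n - u k)"
      using subdifferentialD[OF u, of "x - l k *\<^sub>R u k" n] subdifferentialD[OF u, of "x - l n *\<^sub>R u n" k]
      by (simp add: inner_diff_left inner_diff_right)
    also have "\<dots> = (l k - l n) * inner (u k) (u n - u k) - l n * (norm (u n - u k))\<^sup>2"
      by (simp add: power2_norm_eq_inner inner_diff_left inner_diff_right inner_commute algebra_simps)
    finally have "0 \<le> (l k - l n) * inner (u k) (u n - u k) - l n * (norm (u n - u k))\<^sup>2" .
    moreover have "0 \<le> l n * (norm (u n - u k))\<^sup>2"
      using l[of n] by simp
    ultimately have "0 \<le> (l k - l n) * inner (u k) (u n - u k)"
      by linarith
    then have "0 \<le> inner (u k) (u n - u k)"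
      using \<open>l n < l k\<close> by (simp add: zero_le_mult_iff)
    then show ?thesis
      by (simp add: power2_norm_eq_inner inner_diff_left inner_diff_right inner_commute)
  qed simp
  have "incseq (\<lambda>n. (norm (u n))\<^sup>2)"
  proof (rule incseq_SucI)
    fix n show "(norm (u n))\<^sup>2 \<le> (norm (u (Suc n)))\<^sup>2"
      using dist_le[of n "Suc n"] zero_le_power2[of "norm (u (Suc n) - u n)"] by linarith
  qed
  moreover have "(norm (u n))\<^sup>2 \<le> K\<^sup>2" for n
    using bound by (intro power_mono) auto
  ultimately obtain L where "(\<lambda>n. (norm (u n))\<^sup>2) \<longlonglongrightarrow> L"
    using incseq_convergent by blast
  then have cauchy: "Cauchy (\<lambda>n. (norm (u n))\<^sup>2)"
    by (rule LIMSEQ_imp_Cauchy)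
  have "Cauchy u"
  proof (rule metric_CauchyI)
    fix e :: real assume "e > 0"
    then have "e\<^sup>2 > 0" by simp
    from metric_CauchyD[OF cauchy this] obtain M
      where M: "\<And>i j. i \<ge> M \<Longrightarrow> j \<ge> M \<Longrightarrow> dist ((norm (u i))\<^sup>2) ((norm (u j))\<^sup>2) < e\<^sup>2"
      by blast
    have "dist (u i) (u j) < e" if "i \<ge> M" "j \<ge> M" for i j
    proof -
      have "(norm (u i - u j))\<^sup>2 \<le> dist ((norm (u i))\<^sup>2) ((norm (u j))\<^sup>2)"
        using dist_le[of i j] dist_le[of j i] by (cases "i \<le> j") (auto simp: dist_real_def norm_minus_commute)
      also have "\<dots> < e\<^sup>2"
        using M that by blast
      finally show ?thesis
        using \<open>e > 0\<close> by (simp add: dist_norm power_less_imp_less_base)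
    qed
    then show "\<exists>M. \<forall>m\<ge>M. \<forall>n\<ge>M. dist (u m) (u n) < e" by blast
  qed
  then obtain v where v: "u \<longlonglongrightarrow> v"
    using Cauchy_convergent convergent_def by blast
  have "l \<longlonglongrightarrow> 0"
    unfolding l_def by (rule LIMSEQ_Suc[OF lim_1_over_n])
  then have "(\<lambda>n. x - l n *\<^sub>R u n) \<longlonglongrightarrow> x - 0 *\<^sub>R v"
    by (intro tendsto_intros v)
  then have p: "(\<lambda>n. x - l n *\<^sub>R u n) \<longlonglongrightarrow> x"
    by simp
  have "v \<in> subdifferential f x"
  proof (rule subdifferentialI)
    fix y
    have "(\<lambda>n. inner (y - (x - l n *\<^sub>R u n)) (u n) + f (x - l n *\<^sub>R u n)) \<longlonglongrightarrow> inner (y - x) v + f x"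
      by (intro tendsto_intros p v isCont_tendsto_compose[OF contf])
    then show "inner (y - x) v + f x \<le> f y"
      by (rule LIMSEQ_le_const2) (use subdifferentialD[OF u] in blast)
  qed
  then show ?thesis by blast
qed

text \<open>For a linear functional the subgradient inequality at 0, read at both x and - x, becomes
  an equality.\<close>

lemma riesz_representation:
  fixes L :: "'a::{real_inner, complete_space} \<Rightarrow> real"
  assumes L: "bounded_linear L"
  shows "\<exists>r. \<forall>x. L x = inner x r"
proof -
  interpret bounded_linear L by fact
  have "convex_on UNIV L"
    by (rule convex_onI) (simp_all add: add scaleR)
  moreover have "continuous_on UNIV L"
    by (rule linear_continuous_on) fact
  ultimately obtain r where r: "r \<in> subdifferential L 0"
    using subdifferential_nonempty by blast
  have le: "inner x r \<le> L x" for x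
    using subdifferentialD[OF r, of x] by (simp add: zero)
  have "L x = inner x r" for x
    using le[of x] le[of "- x"] linear_neg[OF bounded_linear.linear[OF L], of x] by simp
  then show ?thesis by blast
qed

text \<open>\<open>adjoint\<close> is a choice operator, so the identity holds as soon as some
  operator satisfies it; Riesz representation supplies its value at each y.\<close>

lemma adjoint_bounded_linear:
  fixes A :: "'a::{real_inner, complete_space} \<Rightarrow> 'b::real_inner"
  assumes "bounded_linear A"
  shows "inner (A x) y = inner x (adjoint A y)"
proof -
  have "\<exists>r. \<forall>x. inner (A x) y = inner x r" for y
    by (intro riesz_representation bounded_linear_compose[OF bounded_linear_inner_left assms])
  then have "\<exists>B. \<forall>x y. inner (A x) y = inner x (B y)"
    by metis
  then show ?thesis
    unfolding adjoint_def by (rule someI2_ex) blast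
qed

section \<open>The subdifferential of a finite maximum\<close>

text \<open>The vector p is a Lagrange multiplier: a subgradient at 0 of the value function of the
  problem perturbed by w, whose value at 0 is F (x, 0).\<close>

lemma marginal_subgradient:
  fixes F :: "'a::real_normed_vector \<times> 'b::{real_inner, complete_space} \<Rightarrow> real"
  assumes F: "convex_on UNIV F" and cont: "continuous_on UNIV F"
    and min: "\<And>y. F (x, 0) \<le> F (y, 0)"
  shows "\<exists>p. \<forall>y w. F (x, 0) + inner w p \<le> F (y, w)"
proof -
  define \<phi> where "\<phi> w = (INF y. F (y, w))" for w
  \<comment> \<open>The midpoint of (y, w) and the reflected point (x, - w) has second component 0,
    where F is at least F (x, 0). The bound does not involve y, so the infimum is finite.\<close>
  have lower: "2 * F (x, 0) - F (x, - w) \<le> F (y, w)" for y w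
  proof -
    have "F ((y, w) + (1/2) *\<^sub>R ((x, - w) - (y, w))) \<le> F (y, w) + 1/2 * (F (x, - w) - F (y, w))"
      by (rule convex_on_segment_le[OF F]) auto
    moreover have "(y, w) + (1/2) *\<^sub>R ((x, - w) - (y, w)) = (y + (1/2) *\<^sub>R (x - y), 0)"
      using scaleR_half_double[of "- w"] by simp
    ultimately have "F (x, 0) \<le> F (y, w) + 1/2 * (F (x, - w) - F (y, w))"
      using min by (metis order_trans)
    then show ?thesis by (simp add: field_simps)
  qed
  have bdd: "bdd_below (range (\<lambda>y. F (y, w)))" for w
    by (rule bdd_belowI2[of _ "2 * F (x, 0) - F (x, - w)"]) (rule lower)
  have \<phi>_le: "\<phi> w \<le> F (y, w)" for y w
    unfolding \<phi>_def by (rule cINF_lower[OF bdd]) simp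
  have \<phi>_ge: "2 * F (x, 0) - F (x, - w) \<le> \<phi> w" for w
    unfolding \<phi>_def by (rule cINF_greatest) (simp_all add: lower)
  have \<phi>_approx: "\<exists>y. F (y, w) < \<phi> w + e" if "e > 0" for w e
    using cInf_lessD[of "range (\<lambda>y. F (y, w))" "\<phi> w + e"] that by (auto simp: \<phi>_def)
  have conv: "convex_on UNIV \<phi>"
  proof (rule convex_onI)
    fix t :: real and v w :: 'b assume t: "0 < t" "t < 1"
    show "\<phi> ((1 - t) *\<^sub>R v + t *\<^sub>R w) \<le> (1 - t) * \<phi> v + t * \<phi> w"
    \<comment> \<open>The infima need not be attained, so minimizers up to e are combined.\<close>
    proof (rule field_le_epsilon)
      fix e :: real assume "e > 0"
      obtain a b where a: "F (a, v) < \<phi> v + e" and b: "F (b, w) < \<phi> w + e"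
        using \<phi>_approx[OF \<open>e > 0\<close>] by metis
      have "\<phi> ((1 - t) *\<^sub>R v + t *\<^sub>R w) \<le> F ((1 - t) *\<^sub>R (a, v) + t *\<^sub>R (b, w))"
        using \<phi>_le by simp
      also have "\<dots> \<le> (1 - t) * F (a, v) + t * F (b, w)"
        using t by (intro convex_onD[OF F]) auto
      also have "\<dots> \<le> (1 - t) * (\<phi> v + e) + t * (\<phi> w + e)"
        using a b t by (intro add_mono mult_left_mono) auto
      finally show "\<phi> ((1 - t) *\<^sub>R v + t *\<^sub>R w) \<le> (1 - t) * \<phi> v + t * \<phi> w + e"
        by (simp add: algebra_simps)
    qed
  qed simp
  have "isCont \<phi> w" for w
  proof -
    \<comment> \<open>A continuous bound for the absolute value of \<phi>, hence a constant bound on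
      a small ball; a convex function bounded on an open ball is continuous there.\<close>
    define B where "B w = \<bar>F (x, w)\<bar> + \<bar>2 * F (x, 0) - F (x, - w)\<bar>" for w
    have B: "\<bar>\<phi> w\<bar> \<le> B w" for w
      using \<phi>_le[of w x] \<phi>_ge[of w] by (simp add: B_def abs_le_iff) linarith
    have "continuous_on UNIV B"
      unfolding B_def by (intro continuous_intros continuous_on_compose2[OF cont]) auto
    then have "open {v. B v < B w + 1}"
      by (intro open_Collect_less continuous_intros)
    then obtain d where d: "d > 0" "ball w d \<subseteq> {v. B v < B w + 1}"
      unfolding open_contains_ball by (metis less_add_one mem_Collect_eq)
    have "continuous_on (ball w d) \<phi>"
    proof (rule convex_on_bounded_continuous[where b = "B w + 1"])
      show "convex_on (ball w d) \<phi>"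
        using convex_on_subset[OF conv] by simp
      show "\<forall>v\<in>ball w d. \<bar>\<phi> v\<bar> \<le> B w + 1"
        using d B by (force intro: order_trans)
    qed simp
    then show ?thesis
      using d(1) by (simp add: continuous_on_eq_continuous_at)
  qed
  then have "continuous_on UNIV \<phi>"
    by (simp add: continuous_at_imp_continuous_on)
  then obtain p where p: "p \<in> subdifferential \<phi> 0"
    using subdifferential_nonempty[OF conv] by blast
  have "F (x, 0) + inner w p \<le> F (y, w)" for y w
  proof -
    have "F (x, 0) \<le> \<phi> 0"
      unfolding \<phi>_def by (rule cINF_greatest) (simp_all add: min)
    with subdifferentialD[OF p, of w] \<phi>_le[of w y] show ?thesis
      by simp
  qed
  then show ?thesis by blast
qed

lemma convex_on_max:
  assumes "convex_on S f" "convex_on S g"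
  shows "convex_on S (\<lambda>x. max (f x) (g x))"
proof (rule convex_onI)
  fix t x y assume t: "0 < t" "t < (1::real)" and xy: "x \<in> S" "y \<in> S"
  have "(1 - t) * a + t * b \<le> (1 - t) * max a c + t * max b d"
      "(1 - t) * c + t * d \<le> (1 - t) * max a c + t * max b d" for a b c d :: real
    using t by (auto intro!: add_mono mult_left_mono)
  then show "max (f ((1 - t) *\<^sub>R x + t *\<^sub>R y)) (g ((1 - t) *\<^sub>R x + t *\<^sub>R y))
      \<le> (1 - t) * max (f x) (g x) + t * max (f y) (g y)"
    using convex_onD[OF assms(1), of t x y] convex_onD[OF assms(2), of t x y] t xy
    by (intro max.boundedI) (auto intro: order_trans)
qed (use assms convex_on_imp_convex in blast)

lemma convex_on_comp_linear:
  assumes "convex_on UNIV f" "linear L"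
  shows "convex_on UNIV (\<lambda>x. f (L x))"
  using assms by (simp add: convex_on_def linear_add linear_scale)

lemma convex_on_linear:
  fixes L :: "'a::real_vector \<Rightarrow> real"
  assumes "linear L"
  shows "convex_on UNIV L"
  using assms by (simp add: convex_on_def linear_add linear_scale)

lemma convex_subdifferential: "convex (subdifferential f x)"
proof (rule convexI)
  fix u v :: 'a and a b :: real
  assume uv: "u \<in> subdifferential f x" "v \<in> subdifferential f x" and ab: "0 \<le> a" "0 \<le> b" "a + b = 1"
  show "a *\<^sub>R u + b *\<^sub>R v \<in> subdifferential f x"
  proof (rule subdifferentialI)
    fix y
    have "inner (y - x) (a *\<^sub>R u + b *\<^sub>R v) + (a + b) * f x
        = a * (inner (y - x) u + f x) + b * (inner (y - x) v + f x)"
      by (simp add: inner_add_right algebra_simps)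
    also have "\<dots> \<le> a * f y + b * f y"
      using ab uv by (intro add_mono mult_left_mono subdifferentialD)
    finally show "inner (y - x) (a *\<^sub>R u + b *\<^sub>R v) + f x \<le> f y"
      using ab(3) by (simp flip: distrib_right)
  qed
qed

text \<open>A subgradient of the value function
  \<open>(v, r) \<mapsto> inf\<^sub>y max (f (y + v) + r - \<langle>y + v, u\<rangle>) (h y - \<langle>y, u\<rangle>)\<close> at the origin
  carries both the convex weight and the splitting of \<open>u\<close>.\<close>

lemma subdifferential_max_subset:
  fixes f h :: "'a::{real_inner, complete_space} \<Rightarrow> real"
  assumes f: "convex_on UNIV f" "continuous_on UNIV f"
    and h: "convex_on UNIV h" "continuous_on UNIV h"
    and eq: "f x = h x"
    and u: "u \<in> subdifferential (\<lambda>y. max (f y) (h y)) x"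
  shows "u \<in> convex hull (subdifferential f x \<union> subdifferential h x)"
proof -
  define c where "c = f x - inner x u"
  \<comment> \<open>The argument is (y, v, r). Subtracting the linear form of u makes x a minimizer
    at v = 0, r = 0, with value c. The summands are arranged so that convexity follows from sums and
    linear substitutions.\<close>
  define F :: "'a \<times> 'a \<times> real \<Rightarrow> real" where
    "F = (\<lambda>p. max (f (fst p + fst (snd p)) + (snd (snd p) - inner (fst p + fst (snd p)) u))
      (h (fst p) + - inner (fst p) u))"
  have convF: "convex_on UNIV F"
    unfolding F_def
    by (intro convex_on_max convex_on_add convex_on_comp_linear[OF f(1)] convex_on_comp_linear[OF h(1)]
        convex_on_linear linearI) (auto simp: algebra_simps inner_add_left)
  have contF: "continuous_on UNIV F"
    unfolding F_def
    by (intro continuous_intros continuous_on_compose2[OF f(2)] continuous_on_compose2[OF h(2)]) auto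
  have F0: "F (x, 0) = c"
    by (simp add: F_def c_def eq zero_prod_def)
  have "F (x, 0) \<le> F (y, 0)" for y
    using subdifferentialD[OF u, of y] unfolding F0
    by (auto simp: F_def c_def eq inner_diff_left zero_prod_def)
  from marginal_subgradient[OF convF contF this] obtain q \<mu>
    where q: "\<And>y v r. c + (inner v q + r * \<mu>) \<le> F (y, v, r)"
    unfolding F0 by auto
  \<comment> \<open>At y = x, v = 0 both members of the maximum equal c. Raising the first by 1
    raises the maximum by 1, and lowering it by 1 leaves the maximum at c; this confines \<mu> to
    the unit interval.\<close>
  have "c + \<mu> \<le> c + 1"
    using q[of 0 1 x] by (simp add: F_def c_def eq)
  moreover have "c - \<mu> \<le> c"
    using q[of 0 "-1" x] by (simp add: F_def c_def eq)
  ultimately have \<mu>: "0 \<le> \<mu>" "\<mu> \<le> 1" by auto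
  \<comment> \<open>The level r is chosen to make the two members of the maximum equal, which leaves
    w and y independent.\<close>
  have key: "c + inner (w - y) q \<le> \<mu> * (f w - inner w u) + (1 - \<mu>) * (h y - inner y u)" for w y
    using q[of "w - y" "(h y - inner y u) - (f w - inner w u)" y] by (simp add: F_def algebra_simps)
  have f_ge: "inner (w - x) q \<le> \<mu> * (f w - f x - inner (w - x) u)" for w
    using key[of w x] by (simp add: c_def eq inner_diff_left algebra_simps)
  have h_ge: "- inner (y - x) q \<le> (1 - \<mu>) * (h y - h x - inner (y - x) u)" for y
    using key[of x y] by (simp add: c_def eq inner_diff_left algebra_simps)
  consider "\<mu> = 0" | "\<mu> = 1" | "0 < \<mu>" "\<mu> < 1"
    using \<mu> by linarith
  then show ?thesis
  proof cases
    case 1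
    \<comment> \<open>With zero weight, \<open>f_ge\<close> bounds a linear form of w - x above by 0
      for all w, which forces q = 0; u then belongs to h alone.\<close>
    then have "inner q q \<le> 0"
      using f_ge[of "x + q"] by simp
    then have "q = 0"
      by (metis inner_gt_zero_iff not_le)
    with h_ge 1 have "u \<in> subdifferential h x"
      by (intro subdifferentialI) (simp add: algebra_simps)
    then show ?thesis by (simp add: hull_inc)
  next
    case 2
    then have "inner q q \<le> 0"
      using h_ge[of "x - q"] by simp
    then have "q = 0"
      by (metis inner_gt_zero_iff not_le)
    with f_ge 2 have "u \<in> subdifferential f x"
      by (intro subdifferentialI) (simp add: algebra_simps)
    then show ?thesis by (simp add: hull_inc)
  next
    case 3
    \<comment> \<open>Dividing \<open>f_ge\<close> and \<open>h_ge\<close> by their weights shows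
      how far u must be moved along q to become a subgradient of each function; in the weighted sum
      the two shifts cancel.\<close>
    define a b where "a = u + (1 / \<mu>) *\<^sub>R q" and "b = u - (1 / (1 - \<mu>)) *\<^sub>R q"
    have "a \<in> subdifferential f x"
    proof (rule subdifferentialI)
      fix y
      have "inner (y - x) q / \<mu> \<le> f y - f x - inner (y - x) u"
        using f_ge[of y] by (simp only: pos_divide_le_eq[OF 3(1)] mult.commute[of _ \<mu>])
      then show "inner (y - x) a + f x \<le> f y"
        by (simp add: a_def inner_add_right)
    qed
    moreover have "b \<in> subdifferential h x"
    proof (rule subdifferentialI)
      fix y
      have "- inner (y - x) q / (1 - \<mu>) \<le> h y - h x - inner (y - x) u"
      proof -
        have "0 < 1 - \<mu>" using 3 by simp
        then show ?thesis
          using h_ge[of y] by (simp only: pos_divide_le_eq mult.commute[of _ "1 - \<mu>"])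
      qed
      then show "inner (y - x) b + h x \<le> h y"
        by (simp add: b_def inner_diff_right)
    qed
    ultimately have "\<mu> *\<^sub>R a + (1 - \<mu>) *\<^sub>R b \<in> convex hull (subdifferential f x \<union> subdifferential h x)"
      using 3 by (intro convexD[OF convex_convex_hull]) (auto intro: hull_inc)
    also have "\<mu> *\<^sub>R a + (1 - \<mu>) *\<^sub>R b = u"
    proof -
      have "\<mu> *\<^sub>R a = \<mu> *\<^sub>R u + q" "(1 - \<mu>) *\<^sub>R b = (1 - \<mu>) *\<^sub>R u - q"
        using 3 by (simp_all add: a_def b_def scaleR_right_distrib scaleR_right_diff_distrib)
      then show ?thesis
        by (simp add: scaleR_left_diff_distrib)
    qed
    finally show ?thesis .
  qed
qed

lemma Max_image_insert:
  fixes f :: "'i \<Rightarrow> 'a \<Rightarrow> 'b::linorder"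
  assumes "finite I" "I \<noteq> {}"
  shows "(\<lambda>x. Max ((\<lambda>i. f i x) ` insert j I)) = (\<lambda>x. max (f j x) (Max ((\<lambda>i. f i x) ` I)))"
  using assms by simp

lemma convex_on_Max:
  assumes "finite I" "I \<noteq> {}" "\<And>i. i \<in> I \<Longrightarrow> convex_on S (f i)"
  shows "convex_on S (\<lambda>x. Max ((\<lambda>i. f i x) ` I))"
  using assms
proof (induction I rule: finite_ne_induct)
  case (insert j I)
  then show ?case
    unfolding Max_image_insert[OF insert.hyps(1,2)] by (intro convex_on_max) auto
qed simp

lemma continuous_on_Max_image:
  fixes f :: "'i \<Rightarrow> 'a::topological_space \<Rightarrow> real"
  assumes "finite I" "I \<noteq> {}" "\<And>i. i \<in> I \<Longrightarrow> continuous_on S (f i)"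
  shows "continuous_on S (\<lambda>x. Max ((\<lambda>i. f i x) ` I))"
  using assms
proof (induction I rule: finite_ne_induct)
  case (insert j I)
  then show ?case
    unfolding Max_image_insert[OF insert.hyps(1,2)] by (intro continuous_on_max) auto
qed simp

text \<open>By continuity the strict inequality persists near x, so the maximum agrees with f
  there.\<close>

lemma subdifferential_max_dominant:
  fixes f h :: "'a::real_inner \<Rightarrow> real"
  assumes f: "convex_on UNIV f" "continuous_on UNIV f" and h: "continuous_on UNIV h"
    and less: "h x < f x"
    and u: "u \<in> subdifferential (\<lambda>y. max (f y) (h y)) x"
  shows "u \<in> subdifferential f x"
proof (rule subdifferential_local[OF f(1) _ _ u])
  have "open {y. h y < f y}"
    by (intro open_Collect_less f h)
  with less show "\<forall>\<^sub>F y in nhds x. max (f y) (h y) \<le> f y"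
    unfolding eventually_nhds by fastforce
qed (use less in simp)

lemma subdifferential_Max:
  fixes f :: "'i \<Rightarrow> 'a::{real_inner, complete_space} \<Rightarrow> real"
  assumes I: "finite I" "I \<noteq> {}"
    and conv: "\<And>i. i \<in> I \<Longrightarrow> convex_on UNIV (f i)"
    and cont: "\<And>i. i \<in> I \<Longrightarrow> continuous_on UNIV (f i)"
  shows "subdifferential (\<lambda>x. Max ((\<lambda>i. f i x) ` I)) x
    = convex hull (\<Union>i\<in>{i \<in> I. f i x = Max ((\<lambda>i. f i x) ` I)}. subdifferential (f i) x)"
proof
  show "convex hull (\<Union>i\<in>{i \<in> I. f i x = Max ((\<lambda>i. f i x) ` I)}. subdifferential (f i) x)
      \<subseteq> subdifferential (\<lambda>x. Max ((\<lambda>i. f i x) ` I)) x"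
  proof (intro hull_minimal convex_subdifferential subsetI, elim UN_E CollectE conjE)
    fix u i assume i: "i \<in> I" "f i x = Max ((\<lambda>i. f i x) ` I)" and u: "u \<in> subdifferential (f i) x"
    show "u \<in> subdifferential (\<lambda>x. Max ((\<lambda>i. f i x) ` I)) x"
    proof (rule subdifferentialI)
      fix y
      have "f i y \<le> Max ((\<lambda>i. f i y) ` I)"
        using I i by simp
      with subdifferentialD[OF u, of y] i(2)
      show "inner (y - x) u + Max ((\<lambda>i. f i x) ` I) \<le> Max ((\<lambda>i. f i y) ` I)"
        by simp
    qed
  qed
next
  let ?G = "\<lambda>I. \<Union>i\<in>{i \<in> I. f i x = Max ((\<lambda>i. f i x) ` I)}. subdifferential (f i) x"
  show "subdifferential (\<lambda>x. Max ((\<lambda>i. f i x) ` I)) x \<subseteq> convex hull ?G I"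
    using I conv cont
  proof (induction I rule: finite_ne_induct)
    case (singleton i)
    then show ?case by (auto intro: hull_inc)
  next
    case (insert j I)
    define h where "h y = Max ((\<lambda>i. f i y) ` I)" for y
    have h: "convex_on UNIV h" "continuous_on UNIV h"
      unfolding h_def using insert by (auto intro!: convex_on_Max continuous_on_Max_image)
    have j: "convex_on UNIV (f j)" "continuous_on UNIV (f j)"
      using insert by auto
    have Max_eq: "Max ((\<lambda>i. f i y) ` insert j I) = max (f j y) (h y)" for y
      using insert.hyps by (simp add: h_def)
    have IH: "subdifferential h x \<subseteq> convex hull ?G I"
      unfolding h_def using insert by blast
    show ?case
    proof
      fix u assume "u \<in> subdifferential (\<lambda>x. Max ((\<lambda>i. f i x) ` insert j I)) x"
      then have u: "u \<in> subdifferential (\<lambda>y. max (f j y) (h y)) x"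
        by (simp only: Max_eq)
      have j_sub: "subdifferential (f j) x \<subseteq> convex hull ?G (insert j I)" if "h x \<le> f j x"
      proof -
        have "f j x = Max ((\<lambda>i. f i x) ` insert j I)"
          using that by (simp only: Max_eq max_absorb1)
        then have "subdifferential (f j) x \<subseteq> ?G (insert j I)" by blast
        then show ?thesis
          using hull_subset by (rule order_trans)
      qed
      \<comment> \<open>If f j does not exceed the old maximum at x, the maximal value is unchanged
        and every active index stays active.\<close>
      have h_sub: "subdifferential h x \<subseteq> convex hull ?G (insert j I)" if "f j x \<le> h x"
      proof -
        have eq: "Max ((\<lambda>i. f i x) ` insert j I) = Max ((\<lambda>i. f i x) ` I)"
          unfolding Max_eq h_def[symmetric] using that by (rule max_absorb2)
        have "?G I \<subseteq> ?G (insert j I)"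
          unfolding eq by (rule UN_mono) auto
        then have "convex hull ?G I \<subseteq> convex hull ?G (insert j I)"
          by (rule hull_mono)
        with IH show ?thesis
          by (rule order_trans)
      qed
      consider "h x < f j x" | "f j x < h x" | "f j x = h x" by linarith
      then show "u \<in> convex hull ?G (insert j I)"
      proof cases
        case 1
        show ?thesis
          by (rule subsetD[OF j_sub[OF less_imp_le[OF 1]] subdifferential_max_dominant[OF j h(2) 1 u]])
      next
        case 2
        have "u \<in> subdifferential (\<lambda>y. max (h y) (f j y)) x"
          using u by (subst max.commute)
        then show ?thesis
          by (rule subsetD[OF h_sub[OF less_imp_le[OF 2]] subdifferential_max_dominant[OF h j(2) 2]])
      next
        case 3
        then have "subdifferential (f j) x \<union> subdifferential h x \<subseteq> convex hull ?G (insert j I)"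
          using j_sub h_sub by (intro Un_least) simp_all
        then have "convex hull (subdifferential (f j) x \<union> subdifferential h x)
            \<subseteq> convex hull ?G (insert j I)"
          by (rule hull_minimal) (rule convex_convex_hull)
        then show ?thesis
          using subdifferential_max_subset[OF j h 3 u] by (rule subsetD)
      qed
    qed
  qed
qed

section \<open>Subgradient projectors\<close>

text \<open>Any global selection can be redefined at the single point x, so its values there exhaust
  the subdifferential. Where h is not positive, one selection must still exist for the set to be {x}
  instead of empty.\<close>

lemma subgrad_proj_set_eq:
  assumes "\<And>y. subdifferential h y \<noteq> {}"
  shows "subgrad_proj_set h x
    = (if h x > 0 then (\<lambda>u. x - (h x / (norm u)\<^sup>2) *\<^sub>R u) ` subdifferential h x else {x})"
proof -
  define s where "s y = (SOME u. u \<in> subdifferential h y)" for y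
  have s: "s y \<in> subdifferential h y" for y
    using assms by (simp add: s_def some_in_eq)
  have range_eq: "(\<lambda>s. s x) ` {s. subgrad_selection h s} = subdifferential h x"
  proof (intro set_eqI iffI)
    fix u assume "u \<in> subdifferential h x"
    then have "subgrad_selection h (s(x := u))"
      using s by (simp add: subgrad_selection_def)
    then show "u \<in> (\<lambda>s. s x) ` {s. subgrad_selection h s}"
      by (intro image_eqI[of _ _ "s(x := u)"]) simp_all
  qed (auto simp: subgrad_selection_def)
  have proj: "subgrad_proj_set h x = (\<lambda>s. subgrad_proj h s x) ` {s. subgrad_selection h s}"
    by (auto simp: subgrad_proj_set_def)
  show ?thesis
  proof (cases "h x > 0")
    case True
    then show ?thesis
      unfolding range_eq[symmetric] proj by (simp add: subgrad_proj_def image_image)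
  next
    case False
    have "subgrad_selection h s"
      using s by (simp add: subgrad_selection_def)
    with False show ?thesis
      unfolding proj by (auto simp: subgrad_proj_def)
  qed
qed

text \<open>The common pattern of most items: M carries subgradients of f at x' to those of g at x,
  and N carries projected points. The map N may depend on x, and \<open>fixed\<close> settles the
  points where the functions are not positive.\<close>

lemma subgrad_proj_set_transfer:
  assumes nonempty: "\<And>y. subdifferential g y \<noteq> {}" "\<And>y. subdifferential f y \<noteq> {}"
    and pos: "g x > 0 \<longleftrightarrow> f x' > 0"
    and sub: "f x' > 0 \<Longrightarrow> subdifferential g x = M ` subdifferential f x'"
    and eq: "\<And>u. f x' > 0 \<Longrightarrow>
      x - (g x / (norm (M u))\<^sup>2) *\<^sub>R M u = N (x' - (f x' / (norm u)\<^sup>2) *\<^sub>R u)"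
    and fixed: "N x' = x"
  shows "subgrad_proj_set g x = N ` subgrad_proj_set f x'"
  unfolding subgrad_proj_set_eq[OF nonempty(1)] subgrad_proj_set_eq[OF nonempty(2)] pos
  by (simp add: sub eq fixed image_image)

lemma subdifferential_minimizer: "(\<And>y. h x \<le> h y) \<Longrightarrow> 0 \<in> subdifferential h x"
  by (simp add: subdifferential_def)

text \<open>Surjectivity of A lets its image test all points, and surjectivity of B writes every
  candidate subgradient as some B u. It serves both scalings and unitary maps.\<close>

lemma subdifferential_comp_adjoint:
  assumes A: "linear A" "surj A" and B: "surj B"
    and AB: "\<And>x y. inner (A x) y = inner x (B y)"
  shows "subdifferential (\<lambda>x. f (A x)) x = B ` subdifferential f (A x)"
proof -
  have "inner (y - x) (B u) = inner (A y - A x) u" for y u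
    using AB[of "y - x" u] A(1) by (simp add: linear_diff)
  then have iff: "B u \<in> subdifferential (\<lambda>x. f (A x)) x \<longleftrightarrow> u \<in> subdifferential f (A x)" for u
    unfolding subdifferential_def using A(2) by (simp, metis surjD)
  show ?thesis
  proof (intro set_eqI iffI)
    fix v assume v: "v \<in> subdifferential (\<lambda>x. f (A x)) x"
    obtain u where "v = B u"
      using B by (rule surjE)
    with v iff show "v \<in> B ` subdifferential f (A x)" by blast
  qed (use iff in blast)
qed

lemma zero_sublevel_comp:
  assumes "\<And>x. B (A x) = x" "\<And>y. A (B y) = y"
  shows "zero_sublevel (\<lambda>x. f (A x)) = B ` zero_sublevel f"
proof (intro set_eqI iffI)
  fix x assume "x \<in> zero_sublevel (\<lambda>x. f (A x))"
  then show "x \<in> B ` zero_sublevel f"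
    using assms(1)[of x] by (intro image_eqI[of _ _ "A x"]) (simp_all add: zero_sublevel_def)
qed (use assms(2) in \<open>auto simp: zero_sublevel_def\<close>)

lemma subdifferential_shift: "subdifferential (\<lambda>x. f (x - z)) x = subdifferential f (x - z)"
proof (intro set_eqI iffI)
  fix u assume u: "u \<in> subdifferential (\<lambda>x. f (x - z)) x"
  show "u \<in> subdifferential f (x - z)"
  proof (rule subdifferentialI)
    fix y show "inner (y - (x - z)) u + f (x - z) \<le> f y"
      using subdifferentialD[OF u, of "y + z"] by (simp add: algebra_simps)
  qed
next
  fix u assume u: "u \<in> subdifferential f (x - z)"
  show "u \<in> subdifferential (\<lambda>x. f (x - z)) x"
  proof (rule subdifferentialI)
    fix y show "inner (y - x) u + f (x - z) \<le> f (y - z)"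
      using subdifferentialD[OF u, of "y - z"] by simp
  qed
qed

lemma subdifferential_powr:
  fixes f :: "'a::real_inner \<Rightarrow> real"
  assumes f: "convex_on UNIV f" and g: "convex_on UNIV (\<lambda>x. f x powr \<alpha>)"
    and nonneg: "\<And>y. 0 \<le> f y" and \<alpha>: "\<alpha> > 0" and pos: "f x > 0"
  shows "subdifferential (\<lambda>x. f x powr \<alpha>) x = (*\<^sub>R) (\<alpha> * f x powr (\<alpha> - 1)) ` subdifferential f x"
proof -
  have fg: "f y = (f y powr \<alpha>) powr inverse \<alpha>" for y
    using \<alpha> nonneg[of y] by (simp add: powr_powr)
  \<comment> \<open>Kept generic in h because it is used for f with exponent \<alpha> and for the
    power of f with the inverse exponent, where the composite is f again.\<close>
  have comp: "(\<beta> * t powr (\<beta> - 1)) *\<^sub>R u \<in> subdifferential (\<lambda>x. h x powr \<beta>) x"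
    if "convex_on UNIV (\<lambda>x. h x powr \<beta>)" "\<beta> > 0" "h x = t" "t > 0" "u \<in> subdifferential h x"
    for h :: "'a \<Rightarrow> real" and \<beta> t u
  proof (rule subdifferential_comp_mono[where \<phi> = "\<lambda>s. s powr \<beta>" and S = "{0<..}"])
    show "((\<lambda>s. s powr \<beta>) has_real_derivative \<beta> * t powr (\<beta> - 1)) (at (h x))"
      using that by (auto intro!: derivative_eq_intros simp: powr_diff)
  qed (use that in \<open>auto intro: powr_mono2\<close>)
  have "v \<in> (*\<^sub>R) (\<alpha> * f x powr (\<alpha> - 1)) ` subdifferential f x"
    if v: "v \<in> subdifferential (\<lambda>x. f x powr \<alpha>) x" for v
  proof -
    \<comment> \<open>Derivatives of mutually inverse powers are reciprocal, so rescaling v by the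
      second factor yields its preimage under the first.\<close>
    have c: "(\<alpha> * f x powr (\<alpha> - 1)) * (inverse \<alpha> * (f x powr \<alpha>) powr (inverse \<alpha> - 1)) = 1"
    proof -
      have "\<alpha> * (inverse \<alpha> - 1) = 1 - \<alpha>"
        using \<alpha> by (simp add: algebra_simps)
      then have "f x powr (\<alpha> - 1) * (f x powr \<alpha>) powr (inverse \<alpha> - 1) = 1"
        using pos by (simp add: powr_powr flip: powr_add)
      moreover have "(\<alpha> * p) * (inverse \<alpha> * q) = p * q" for p q :: real
        using \<alpha> by (simp add: field_simps)
      ultimately show ?thesis by (simp only:)
    qed
    have "(inverse \<alpha> * (f x powr \<alpha>) powr (inverse \<alpha> - 1)) *\<^sub>R v \<in> subdifferential f x"
      using comp[of "\<lambda>x. f x powr \<alpha>" "inverse \<alpha>" "f x powr \<alpha>" v] \<alpha> pos f v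
      by (simp flip: fg)
    then show ?thesis
      using c by (intro image_eqI[where x = "(inverse \<alpha> * (f x powr \<alpha>) powr (inverse \<alpha> - 1)) *\<^sub>R v"]) simp_all
  qed
  moreover have "(*\<^sub>R) (\<alpha> * f x powr (\<alpha> - 1)) ` subdifferential f x \<subseteq> subdifferential (\<lambda>x. f x powr \<alpha>) x"
    using comp[OF g \<alpha> refl pos] by blast
  ultimately show ?thesis by blast
qed

lemma subdifferential_pos_part:
  fixes f :: "'a::real_inner \<Rightarrow> real"
  assumes f: "convex_on UNIV f" "continuous_on UNIV f" and pos: "f x > 0"
  shows "subdifferential (\<lambda>x. max (f x) 0) x = subdifferential f x"
proof
  show "subdifferential (\<lambda>x. max (f x) 0) x \<subseteq> subdifferential f x"
    by (rule subsetI, rule subdifferential_max_dominant[OF f continuous_on_const pos])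
  show "subdifferential f x \<subseteq> subdifferential (\<lambda>x. max (f x) 0) x"
    using pos by (auto simp: subdifferential_def intro: order_trans[OF _ max.cobounded1])
qed

section \<open>The Moreau envelope\<close>

text \<open>The definite description needs uniqueness: adding the subgradient inequalities of two
  solutions bounds their squared distance by 0.\<close>

lemma prox_mem_subdifferential:
  fixes f :: "'a::{real_inner, complete_space} \<Rightarrow> real"
  assumes "convex_on UNIV f" "continuous_on UNIV f"
  shows "x - prox f x \<in> subdifferential f (prox f x)"
proof -
  obtain p where p: "x - p \<in> subdifferential f p"
    using prox_point_exists[OF assms] by blast
  have "prox f x = p"
    unfolding prox_def
  proof (rule the_equality)
    show "\<exists>u\<in>subdifferential f p. x = p + u"
      using p by (intro bexI[of _ "x - p"]) auto
    fix q assume "\<exists>u\<in>subdifferential f q. x = q + u"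
    then have q: "x - q \<in> subdifferential f q" by auto
    have "inner (q - p) (x - p) + inner (p - q) (x - q) \<le> 0"
      using subdifferentialD[OF p, of q] subdifferentialD[OF q, of p] by simp
    also have "inner (q - p) (x - p) + inner (p - q) (x - q) = inner (q - p) (q - p)"
      by (simp add: inner_diff_left inner_diff_right inner_commute)
    finally show "q = p"
      by (metis inner_gt_zero_iff not_le right_minus_eq)
  qed
  with p show ?thesis by simp
qed

context
  fixes f :: "'a::{real_inner, complete_space} \<Rightarrow> real" and g :: "'a \<Rightarrow> real"
  assumes f: "convex_on UNIV f" "continuous_on UNIV f"
  defines "g \<equiv> inf_conv f (\<lambda>x. (norm x)\<^sup>2 / 2)"
begin

text \<open>Add the subgradient inequality at the proximal point to the nonnegativity of a square.
  With y = x this shows that the proximal point attains the infimum; for general y it is the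
  subgradient inequality of the envelope.\<close>

lemma moreau_envelope_ge:
  "f (prox f x) + (norm (x - prox f x))\<^sup>2 / 2 + inner (y - x) (x - prox f x) \<le> f w + (norm (y - w))\<^sup>2 / 2"
proof -
  define p where "p = prox f x"
  have "0 \<le> (norm ((x - p) - (y - w)))\<^sup>2" by simp
  also have "\<dots> = 2 * inner (w - p) (x - p) + (norm (y - w))\<^sup>2 - (norm (x - p))\<^sup>2 - 2 * inner (y - x) (x - p)"
    by (simp add: power2_norm_eq_inner inner_diff_left inner_diff_right inner_commute)
  finally have "inner (y - x) (x - p) + (norm (x - p))\<^sup>2 / 2 \<le> inner (w - p) (x - p) + (norm (y - w))\<^sup>2 / 2"
    by simp
  moreover have "inner (w - p) (x - p) + f p \<le> f w"
    unfolding p_def by (rule subdifferentialD[OF prox_mem_subdifferential[OF f]])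
  ultimately show ?thesis
    unfolding p_def by linarith
qed

lemma moreau_envelope_le: "g y \<le> f w + (norm (y - w))\<^sup>2 / 2"
  unfolding g_def inf_conv_def
proof (rule cINF_lower)
  show "bdd_below (range (\<lambda>w. f w + (norm (y - w))\<^sup>2 / 2))"
    by (rule bdd_belowI2[of _ "f (prox f y) + (norm (y - prox f y))\<^sup>2 / 2"])
      (use moreau_envelope_ge[of y y] in simp)
qed simp

lemma moreau_envelope_eq: "g x = f (prox f x) + (norm (x - prox f x))\<^sup>2 / 2"
proof (rule antisym[OF moreau_envelope_le])
  show "f (prox f x) + (norm (x - prox f x))\<^sup>2 / 2 \<le> g x"
    unfolding g_def inf_conv_def
    by (rule cINF_greatest) (use moreau_envelope_ge[of x x] in simp_all)
qed

lemma subdifferential_moreau_envelope: "subdifferential g x = {x - prox f x}"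
proof (intro equalityI subsetI)
  fix v assume "v \<in> {x - prox f x}"
  moreover have "x - prox f x \<in> subdifferential g x"
  proof (rule subdifferentialI)
    fix y show "inner (y - x) (x - prox f x) + g x \<le> g y"
      using moreau_envelope_ge[of x y "prox f y"] by (simp add: moreau_envelope_eq[of x] moreau_envelope_eq[of y])
  qed
  ultimately show "v \<in> subdifferential g x" by simp
next
  fix v assume v: "v \<in> subdifferential g x"
  \<comment> \<open>Inserting the proximal point of x in the envelope at x + d gives a quadratic
    upper bound with gradient u at x. Testing v in the direction v - u leaves the square of the norm
    of d at most half of itself.\<close>
  define u d where "u = x - prox f x" and "d = v - u"
  have "inner d v + g x \<le> g (x + d)"
    using subdifferentialD[OF v, of "x + d"] by simp
  also have "\<dots> \<le> f (prox f x) + (norm (x + d - prox f x))\<^sup>2 / 2"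
    by (rule moreau_envelope_le)
  also have "x + d - prox f x = u + d"
    by (simp add: u_def)
  also have "f (prox f x) + (norm (u + d))\<^sup>2 / 2 = g x + inner d u + (norm d)\<^sup>2 / 2"
    unfolding moreau_envelope_eq[of x] u_def[symmetric]
    by (simp add: power2_norm_eq_inner inner_add_left inner_add_right inner_commute add_divide_distrib)
  finally have "inner d d \<le> (norm d)\<^sup>2 / 2"
    by (simp add: d_def inner_diff_right)
  then have "d = 0"
    by (simp add: power2_norm_eq_inner[symmetric])
  then show "v \<in> {x - prox f x}"
    by (simp add: d_def u_def)
qed

lemma moreau_envelope_zero_iff:
  assumes nonneg: "\<And>y. 0 \<le> f y"
  shows "g x \<le> 0 \<longleftrightarrow> f x \<le> 0"
proof
  assume "f x \<le> 0"
  with moreau_envelope_le[of x x] show "g x \<le> 0" by simp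
next
  assume "g x \<le> 0"
  then have le: "f (prox f x) + (norm (x - prox f x))\<^sup>2 / 2 \<le> 0"
    by (simp add: moreau_envelope_eq)
  with nonneg[of "prox f x"] have "(norm (x - prox f x))\<^sup>2 \<le> 0"
    by linarith
  then have "prox f x = x" by simp
  with le show "f x \<le> 0" by simp
qed

end

theorem proposition3p1:
  fixes f :: "'a::{real_inner, complete_space} \<Rightarrow> real"
    and \<alpha> :: real
    and A :: "'a \<Rightarrow> 'a"
    and z :: 'a
    and I :: "'i set"
    and fi :: "'i \<Rightarrow> 'a \<Rightarrow> real"
  assumes "convex_on UNIV f" and "continuous_on UNIV f"
    and "zero_sublevel f \<noteq> {}"
    and "\<alpha> > 0"
    and "bounded_linear A"
    and "A \<circ> adjoint A = id" and "adjoint A \<circ> A = id"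
    and "finite I" and "I \<noteq> {}"
    and "\<And>i. i \<in> I \<Longrightarrow> convex_on UNIV (fi i)"
    and "\<And>i. i \<in> I \<Longrightarrow> continuous_on UNIV (fi i)"
    and "(\<Inter>i\<in>I. zero_sublevel (fi i)) \<noteq> {}"
  shows
    "(let g = (\<lambda>x. \<alpha> * f x) in
        zero_sublevel g = zero_sublevel f \<and>
        subgrad_proj_set g = subgrad_proj_set f) \<and>
     (let g = (\<lambda>x. f (\<alpha> *\<^sub>R x)) in
        zero_sublevel g = (\<lambda>x. inverse \<alpha> *\<^sub>R x) ` zero_sublevel f \<and>
        (\<forall>x. subgrad_proj_set g x = (\<lambda>p. inverse \<alpha> *\<^sub>R p) ` subgrad_proj_set f (\<alpha> *\<^sub>R x))) \<and>
     (let g = (\<lambda>x. f x powr \<alpha>) in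
        (\<forall>x. f x \<ge> 0) \<and> convex_on UNIV g \<longrightarrow>
          zero_sublevel g = zero_sublevel f \<and>
          (\<forall>x. subgrad_proj_set g x =
             (\<lambda>p. (1 - inverse \<alpha>) *\<^sub>R x + inverse \<alpha> *\<^sub>R p) ` subgrad_proj_set f x)) \<and>
     (let g = f \<circ> A in
        zero_sublevel g = adjoint A ` zero_sublevel f \<and>
        (\<forall>x. subgrad_proj_set g x = adjoint A ` subgrad_proj_set f (A x))) \<and>
     (let g = (\<lambda>x. f (x - z)) in
        zero_sublevel g = (\<lambda>x. z + x) ` zero_sublevel f \<and>
        (\<forall>x. subgrad_proj_set g x = (\<lambda>p. z + p) ` subgrad_proj_set f (x - z))) \<and>
     (let g = (\<lambda>x. Max ((\<lambda>i. fi i x) ` I)) in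
        zero_sublevel g = (\<Inter>i\<in>I. zero_sublevel (fi i)) \<and>
        (\<forall>x. g x > 0 \<longrightarrow>
           subgrad_proj_set g x =
             {x - (g x / (norm u)\<^sup>2) *\<^sub>R u | u.
                u \<in> convex hull (\<Union>i\<in>{i \<in> I. fi i x = g x}. subdifferential (fi i) x)})) \<and>
     (let g = (\<lambda>x. max (f x) 0) in
        subgrad_proj_set g = subgrad_proj_set f) \<and>
     (let g = inf_conv f (\<lambda>x. (norm x)\<^sup>2 / 2) in
        0 \<in> range f \<and> (\<forall>x. f x \<ge> 0) \<longrightarrow>
          zero_sublevel g = zero_sublevel f \<and>
          (\<forall>x. subgrad_proj_set g x =
             {if f x > 0
              then x - (g x / (norm (x - prox f x))\<^sup>2) *\<^sub>R (x - prox f x)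
              else x}))"
proof -
  have f: "convex_on UNIV f" "continuous_on UNIV f" by fact+
  have \<alpha>: "\<alpha> > 0" by fact
  have nonempty: "subdifferential f x \<noteq> {}" for x
    by (rule subdifferential_nonempty[OF f])
  show ?thesis
    unfolding Let_def
  proof (intro conjI)
    let ?g = "\<lambda>x. \<alpha> * f x"
    show "zero_sublevel ?g = zero_sublevel f"
      using \<alpha> by (simp add: zero_sublevel_def mult_le_0_iff)
    have g_nonempty: "subdifferential ?g y \<noteq> {}" for y
      using nonempty by (simp add: subdifferential_cmult[OF \<alpha>])
    show "subgrad_proj_set ?g = subgrad_proj_set f"
    proof
      fix x
      have "subgrad_proj_set ?g x = (\<lambda>p. p) ` subgrad_proj_set f x"
      proof (rule subgrad_proj_set_transfer[OF g_nonempty nonempty _ subdifferential_cmult[OF \<alpha>]])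
        fix u :: 'a
        have "\<alpha> * f x / (norm (\<alpha> *\<^sub>R u))\<^sup>2 * \<alpha> = f x / (norm u)\<^sup>2"
          using \<alpha> by (simp add: power2_eq_square)
        then show "x - (\<alpha> * f x / (norm (\<alpha> *\<^sub>R u))\<^sup>2) *\<^sub>R \<alpha> *\<^sub>R u
            = x - (f x / (norm u)\<^sup>2) *\<^sub>R u"
          by (simp only: scaleR_scaleR)
      qed (use \<alpha> in \<open>simp_all add: zero_less_mult_iff\<close>)
      then show "subgrad_proj_set ?g x = subgrad_proj_set f x" by simp
    qed
  next
    let ?g = "\<lambda>x. f (\<alpha> *\<^sub>R x)"
    show "zero_sublevel ?g = (\<lambda>x. inverse \<alpha> *\<^sub>R x) ` zero_sublevel f"
      using \<alpha> by (intro zero_sublevel_comp) simp_all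
    show "\<forall>x. subgrad_proj_set ?g x = (\<lambda>p. inverse \<alpha> *\<^sub>R p) ` subgrad_proj_set f (\<alpha> *\<^sub>R x)"
    proof
      fix x
      have "surj ((*\<^sub>R) \<alpha> :: 'a \<Rightarrow> 'a)"
        using \<alpha> by (intro surjI[of _ "(*\<^sub>R) (inverse \<alpha>)"]) simp
      then have sub: "subdifferential ?g y = (*\<^sub>R) \<alpha> ` subdifferential f (\<alpha> *\<^sub>R y)" for y
        by (intro subdifferential_comp_adjoint linear_scale_self) simp_all
      have g_nonempty: "subdifferential ?g y \<noteq> {}" for y
        using nonempty by (simp add: sub)
      show "subgrad_proj_set ?g x = (\<lambda>p. inverse \<alpha> *\<^sub>R p) ` subgrad_proj_set f (\<alpha> *\<^sub>R x)"
      proof (rule subgrad_proj_set_transfer[OF g_nonempty nonempty _ sub])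
        fix u :: 'a
        have "f (\<alpha> *\<^sub>R x) / (norm (\<alpha> *\<^sub>R u))\<^sup>2 * \<alpha> = inverse \<alpha> * (f (\<alpha> *\<^sub>R x) / (norm u)\<^sup>2)"
          using \<alpha> by (simp add: power2_eq_square divide_inverse)
        then show "x - (f (\<alpha> *\<^sub>R x) / (norm (\<alpha> *\<^sub>R u))\<^sup>2) *\<^sub>R \<alpha> *\<^sub>R u
            = inverse \<alpha> *\<^sub>R (\<alpha> *\<^sub>R x - (f (\<alpha> *\<^sub>R x) / (norm u)\<^sup>2) *\<^sub>R u)"
          using \<alpha> by (simp only: scaleR_scaleR scaleR_right_diff_distrib) simp
      qed (use \<alpha> in simp_all)
    qed
  next
    let ?g = "\<lambda>x. f x powr \<alpha>"
    show "(\<forall>x. 0 \<le> f x) \<and> convex_on UNIV ?g \<longrightarrow>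
        zero_sublevel ?g = zero_sublevel f \<and>
        (\<forall>x. subgrad_proj_set ?g x =
          (\<lambda>p. (1 - inverse \<alpha>) *\<^sub>R x + inverse \<alpha> *\<^sub>R p) ` subgrad_proj_set f x)"
    proof (intro impI conjI allI; elim conjE)
      assume nonneg: "\<forall>x. 0 \<le> f x" and g: "convex_on UNIV ?g"
      have zero: "?g y \<le> 0 \<longleftrightarrow> f y \<le> 0" for y
        using nonneg[rule_format, of y] by (auto simp: order_le_less)
      then show "zero_sublevel ?g = zero_sublevel f"
        by (simp add: zero_sublevel_def)
      have sub: "subdifferential ?g y = (*\<^sub>R) (\<alpha> * f y powr (\<alpha> - 1)) ` subdifferential f y"
        if "f y > 0" for y
        using subdifferential_powr[OF f(1) g _ \<alpha> that] nonneg by blast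
      have g_nonempty: "subdifferential ?g y \<noteq> {}" for y
      proof (cases "f y > 0")
        case True
        then show ?thesis using nonempty by (simp add: sub)
      next
        case False
        then have "f y = 0"
          using nonneg[rule_format, of y] by simp
        then have "0 \<in> subdifferential ?g y"
          by (intro subdifferential_minimizer) simp
        then show ?thesis by blast
      qed
      fix x
      show "subgrad_proj_set ?g x =
          (\<lambda>p. (1 - inverse \<alpha>) *\<^sub>R x + inverse \<alpha> *\<^sub>R p) ` subgrad_proj_set f x"
      proof (rule subgrad_proj_set_transfer[OF g_nonempty nonempty _ sub])
        fix u :: 'a assume pos: "f x > 0"
        \<comment> \<open>The value is f x * t and the subgradient factor is \<alpha> * t, so t
          cancels in the projector and only the inverse of \<alpha> remains.\<close>
        define t where "t = f x powr (\<alpha> - 1)"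
        have t: "t > 0" and ft: "?g x = f x * t"
          using pos by (simp_all add: t_def powr_diff)
        have "f x * t / (norm ((\<alpha> * t) *\<^sub>R u))\<^sup>2 * (\<alpha> * t) = inverse \<alpha> * (f x / (norm u)\<^sup>2)"
          using \<alpha> t by (cases "u = 0") (simp_all add: power2_eq_square divide_simps)
        then have "x - (f x * t / (norm ((\<alpha> * t) *\<^sub>R u))\<^sup>2) *\<^sub>R (\<alpha> * t) *\<^sub>R u
            = x - (inverse \<alpha> * (f x / (norm u)\<^sup>2)) *\<^sub>R u"
          by (simp only: scaleR_scaleR)
        then show "x - (?g x / (norm ((\<alpha> * f x powr (\<alpha> - 1)) *\<^sub>R u))\<^sup>2) *\<^sub>R (\<alpha> * f x powr (\<alpha> - 1)) *\<^sub>R u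
            = (1 - inverse \<alpha>) *\<^sub>R x + inverse \<alpha> *\<^sub>R (x - (f x / (norm u)\<^sup>2) *\<^sub>R u)"
          unfolding ft t_def[symmetric]
          by (simp only: scaleR_right_diff_distrib scaleR_left_diff_distrib scaleR_scaleR) simp
      qed (use zero[of x] in \<open>auto simp: not_le[symmetric] simp flip: scaleR_add_left\<close>)
    qed
  next
    let ?g = "f \<circ> A"
    have adj: "inner (A x) y = inner x (adjoint A y)" for x y
      by (rule adjoint_bounded_linear) fact
    have AB: "A (adjoint A x) = x" and BA: "adjoint A (A x) = x" for x
      using assms(6,7) by (simp_all add: fun_eq_iff)
    have A: "linear A"
      by (rule bounded_linear.linear) fact
    have norm_adj: "norm (adjoint A u) = norm u" for u
      using adj[of "adjoint A u" u] by (simp add: norm_eq_sqrt_inner AB)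
    show "zero_sublevel ?g = adjoint A ` zero_sublevel f"
      unfolding comp_def by (rule zero_sublevel_comp[OF BA AB])
    have surj: "surj A" "surj (adjoint A)"
      by (rule surjI, rule AB, rule surjI, rule BA)
    have sub: "subdifferential ?g y = adjoint A ` subdifferential f (A y)" for y
      unfolding comp_def
      by (rule subdifferential_comp_adjoint[OF A surj adj])
    have g_nonempty: "subdifferential ?g y \<noteq> {}" for y
      using nonempty by (simp add: sub)
    show "\<forall>x. subgrad_proj_set ?g x = adjoint A ` subgrad_proj_set f (A x)"
    proof
      fix x
      show "subgrad_proj_set ?g x = adjoint A ` subgrad_proj_set f (A x)"
      proof (rule subgrad_proj_set_transfer[OF g_nonempty nonempty _ sub])
        fix u :: 'a
        \<comment> \<open>The two points are compared after applying A, whose linearity is at hand;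
          \<open>BA\<close> undoes this.\<close>
        have "A (x - (?g x / (norm (adjoint A u))\<^sup>2) *\<^sub>R adjoint A u)
            = A x - (f (A x) / (norm u)\<^sup>2) *\<^sub>R u"
          by (simp add: linear_diff[OF A] linear_scale[OF A] AB norm_adj)
        then show "x - (?g x / (norm (adjoint A u))\<^sup>2) *\<^sub>R adjoint A u
            = adjoint A (A x - (f (A x) / (norm u)\<^sup>2) *\<^sub>R u)"
          by (metis BA)
      qed (simp_all add: BA)
    qed
  next
    let ?g = "\<lambda>x. f (x - z)"
    show "zero_sublevel ?g = (\<lambda>x. z + x) ` zero_sublevel f"
      by (rule zero_sublevel_comp) simp_all
    have g_nonempty: "subdifferential ?g y \<noteq> {}" for y
      using nonempty by (simp add: subdifferential_shift)
    show "\<forall>x. subgrad_proj_set ?g x = (\<lambda>p. z + p) ` subgrad_proj_set f (x - z)"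
    proof
      fix x
      show "subgrad_proj_set ?g x = (\<lambda>p. z + p) ` subgrad_proj_set f (x - z)"
        by (rule subgrad_proj_set_transfer[OF g_nonempty nonempty, where M = "\<lambda>u. u"])
          (simp_all add: subdifferential_shift)
    qed
  next
    let ?g = "\<lambda>x. Max ((\<lambda>i. fi i x) ` I)"
    show "zero_sublevel ?g = (\<Inter>i\<in>I. zero_sublevel (fi i))"
      using \<open>finite I\<close> \<open>I \<noteq> {}\<close> by (auto simp: zero_sublevel_def)
    have g_nonempty: "subdifferential ?g y \<noteq> {}" for y
      using assms(8-11) by (intro subdifferential_nonempty convex_on_Max continuous_on_Max_image)
    show "\<forall>x. ?g x > 0 \<longrightarrow> subgrad_proj_set ?g x =
        {x - (?g x / (norm u)\<^sup>2) *\<^sub>R u | u.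
          u \<in> convex hull (\<Union>i\<in>{i \<in> I. fi i x = ?g x}. subdifferential (fi i) x)}"
    proof (intro allI impI)
      fix x assume pos: "?g x > 0"
      have sub: "subdifferential ?g x
          = convex hull (\<Union>i\<in>{i \<in> I. fi i x = ?g x}. subdifferential (fi i) x)"
        using assms(8-11) by (rule subdifferential_Max)
      show "subgrad_proj_set ?g x = {x - (?g x / (norm u)\<^sup>2) *\<^sub>R u | u.
          u \<in> convex hull (\<Union>i\<in>{i \<in> I. fi i x = ?g x}. subdifferential (fi i) x)}"
        unfolding subgrad_proj_set_eq[of ?g, OF g_nonempty] sub[symmetric] if_P[OF pos]
        by (simp only: setcompr_eq_image Collect_mem_eq)
    qed
  next
    let ?g = "\<lambda>x. max (f x) 0"
    have g_nonempty: "subdifferential ?g y \<noteq> {}" for y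
      using f by (intro subdifferential_nonempty convex_on_max continuous_intros)
        (simp_all add: convex_on_const)
    show "subgrad_proj_set ?g = subgrad_proj_set f"
    proof
      fix x
      have "subgrad_proj_set ?g x = (\<lambda>p. p) ` subgrad_proj_set f x"
        by (rule subgrad_proj_set_transfer[OF g_nonempty nonempty, where M = "\<lambda>u. u"])
          (simp_all add: subdifferential_pos_part[OF f] less_max_iff_disj)
      then show "subgrad_proj_set ?g x = subgrad_proj_set f x" by simp
    qed
  next
    let ?g = "inf_conv f (\<lambda>x. (norm x)\<^sup>2 / 2)"
    \<comment> \<open>The explicit singleton gives nonemptiness without a separate proof that the
      envelope is convex and continuous.\<close>
    have g_nonempty: "subdifferential ?g y \<noteq> {}" for y
      by (simp add: subdifferential_moreau_envelope[OF f])
    show "0 \<in> range f \<and> (\<forall>x. 0 \<le> f x) \<longrightarrow>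
        zero_sublevel ?g = zero_sublevel f \<and>
        (\<forall>x. subgrad_proj_set ?g x =
          {if f x > 0 then x - (?g x / (norm (x - prox f x))\<^sup>2) *\<^sub>R (x - prox f x) else x})"
    proof
      assume "0 \<in> range f \<and> (\<forall>x. 0 \<le> f x)"
      then have iff: "?g x \<le> 0 \<longleftrightarrow> f x \<le> 0" for x
        by (intro moreau_envelope_zero_iff[OF f]) simp
      then have pos: "?g x > 0 \<longleftrightarrow> f x > 0" for x
        by (simp flip: not_le)
      show "zero_sublevel ?g = zero_sublevel f \<and>
          (\<forall>x. subgrad_proj_set ?g x =
            {if f x > 0 then x - (?g x / (norm (x - prox f x))\<^sup>2) *\<^sub>R (x - prox f x) else x})"
        unfolding subgrad_proj_set_eq[of ?g, OF g_nonempty] pos subdifferential_moreau_envelope[OF f]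
        by (simp add: zero_sublevel_def iff)
    qed
  qed
qed

end
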